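(* Suppose $\delta$ is a cardinal and $\kappa\ge\delta$ is a strong limit cardinal. Suppose $D$ is an ultrafilter over a set of cardinality less than $\delta$, $X$ is a set in $M_D$, and $W$ is an $M_D$-$\kappa$-complete $M_D$-ultrafilter over $X$. Assume that every $\kappa$-complete filter over $X$ extends to a $\delta$-complete ultrafilter. Then $W\in M_D$.
   Context: $M_D$ denotes the (possibly ill-founded) ultrapower of $V$ by $D$; elements of $M_D$ are identified with their extensions $\{y\in M_D: M_D\models y\in x\}$. For a model $M$ of set theory and $X\in M$, an $M$-ultrafilter over $X$ is an ultrafilter on the partial order $(P^M(X),\subseteq^M)$. An $M$-ultrafilter $W$ is $M$-$\kappa$-complete if for every $\sigma\subseteq W$ with $\sigma\in M$ and $|\sigma|<\kappa$ (true cardinality of its extension), $\bigcap\sigma\in W$. $W\in M_D$ means there is an element of $M_D$ whose extension is $W$. *)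

theory Defs
  imports "HOL-Library.Equipollence" "HOL-Library.FuncSet"
begin

text \<open>
  A structure for the language of set theory is a carrier with a binary relation.  An element
  of a structure is identified with its extension.
\<close>

type_synonym 'm set_model = "'m set \<times> ('m \<Rightarrow> 'm \<Rightarrow> bool)"

definition ext :: "'m set_model \<Rightarrow> 'm \<Rightarrow> 'm set" where
  "ext M x = {y \<in> fst M. snd M y x}"

definition sub_in :: "'m set_model \<Rightarrow> 'm \<Rightarrow> 'm \<Rightarrow> bool" where
  "sub_in M x y \<longleftrightarrow> (\<forall>z\<in>fst M. snd M z x \<longrightarrow> snd M z y)"

definition powerset_in :: "'m set_model \<Rightarrow> 'm \<Rightarrow> 'm set" where
  "powerset_in M X = {A \<in> fst M. sub_in M A X}"

text \<open>
  The universe \<open>V\<close> is a type \<open>'v\<close> with a membership relation satisfying ZFC.  Separation and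
  Replacement range over all HOL predicates and functions, so the subsets of \<open>ext V a\<close> and the
  functions defined on \<open>ext V a\<close> are, as HOL objects, exactly those that are elements of the
  universe, and cardinality comparisons between sets may be made in HOL.  Choice holds in
  the universe because it holds in HOL.
\<close>

locale zfc_universe =
  fixes mem :: "'v \<Rightarrow> 'v \<Rightarrow> bool" (infix \<open>\<epsilon>\<close> 50)
  assumes extensionality: "(\<And>z. z \<epsilon> x \<longleftrightarrow> z \<epsilon> y) \<Longrightarrow> x = y"
    and foundation: "y \<epsilon> x \<Longrightarrow> \<exists>m. m \<epsilon> x \<and> (\<forall>z. z \<epsilon> x \<longrightarrow> \<not> z \<epsilon> m)"
    and pairing: "\<exists>p. \<forall>z. z \<epsilon> p \<longleftrightarrow> z = x \<or> z = y"
    and union: "\<exists>u. \<forall>z. z \<epsilon> u \<longleftrightarrow> (\<exists>y. y \<epsilon> x \<and> z \<epsilon> y)"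
    and powerset: "\<exists>p. \<forall>y. y \<epsilon> p \<longleftrightarrow> (\<forall>z. z \<epsilon> y \<longrightarrow> z \<epsilon> x)"
    and infinity: "\<exists>w. (\<exists>e. e \<epsilon> w \<and> (\<forall>z. \<not> z \<epsilon> e)) \<and>
        (\<forall>x. x \<epsilon> w \<longrightarrow> (\<exists>s. s \<epsilon> w \<and> (\<forall>z. z \<epsilon> s \<longleftrightarrow> z \<epsilon> x \<or> z = x)))"
    and separation: "\<exists>y. \<forall>z. z \<epsilon> y \<longleftrightarrow> z \<epsilon> x \<and> P z"
    and replacement: "\<exists>y. \<forall>z. z \<epsilon> y \<longleftrightarrow> (\<exists>u. u \<epsilon> x \<and> z = F u)"

definition universe :: "('v \<Rightarrow> 'v \<Rightarrow> bool) \<Rightarrow> 'v set_model" where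
  "universe E = (UNIV, E)"

abbreviation elts :: "('v \<Rightarrow> 'v \<Rightarrow> bool) \<Rightarrow> 'v \<Rightarrow> 'v set" where
  "elts E \<equiv> ext (universe E)"

text \<open>
  Von Neumann ordinals and cardinals.  Under Foundation, a transitive set linearly ordered by
  membership is well-ordered by it.  If \<open>\<kappa>\<close> is a cardinal, then \<open>|S| < \<kappa>\<close> is
  \<open>S \<prec> elts E \<kappa>\<close>.
\<close>

definition ordinal :: "('v \<Rightarrow> 'v \<Rightarrow> bool) \<Rightarrow> 'v \<Rightarrow> bool" where
  "ordinal E a \<longleftrightarrow> (\<forall>x\<in>elts E a. elts E x \<subseteq> elts E a) \<and>
     (\<forall>x\<in>elts E a. \<forall>y\<in>elts E a. E x y \<or> x = y \<or> E y x)"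

definition cardinal :: "('v \<Rightarrow> 'v \<Rightarrow> bool) \<Rightarrow> 'v \<Rightarrow> bool" where
  "cardinal E k \<longleftrightarrow> ordinal E k \<and> (\<forall>a\<in>elts E k. \<not> elts E a \<approx> elts E k)"

definition strong_limit_cardinal :: "('v \<Rightarrow> 'v \<Rightarrow> bool) \<Rightarrow> 'v \<Rightarrow> bool" where
  "strong_limit_cardinal E k \<longleftrightarrow> cardinal E k \<and> infinite (elts E k) \<and>
     (\<forall>l\<in>elts E k. cardinal E l \<longrightarrow> Pow (elts E l) \<prec> elts E k)"

text \<open>Filters are proper.  For a poset with least element this says the least element is omitted.\<close>

definition poset_filter :: "'p set \<Rightarrow> ('p \<Rightarrow> 'p \<Rightarrow> bool) \<Rightarrow> 'p set \<Rightarrow> bool" where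
  "poset_filter P le F \<longleftrightarrow> F \<subseteq> P \<and> F \<noteq> {} \<and> F \<noteq> P \<and>
     (\<forall>x\<in>F. \<forall>y\<in>P. le x y \<longrightarrow> y \<in> F) \<and>
     (\<forall>x\<in>F. \<forall>y\<in>F. \<exists>z\<in>F. le z x \<and> le z y)"

definition poset_ultrafilter :: "'p set \<Rightarrow> ('p \<Rightarrow> 'p \<Rightarrow> bool) \<Rightarrow> 'p set \<Rightarrow> bool" where
  "poset_ultrafilter P le U \<longleftrightarrow> poset_filter P le U \<and>
     (\<forall>F. poset_filter P le F \<and> U \<subseteq> F \<longrightarrow> F = U)"

abbreviation filter_over :: "'a set \<Rightarrow> 'a set set \<Rightarrow> bool" where
  "filter_over X \<equiv> poset_filter (Pow X) (\<subseteq>)"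

abbreviation ultrafilter_over :: "'a set \<Rightarrow> 'a set set \<Rightarrow> bool" where
  "ultrafilter_over X \<equiv> poset_ultrafilter (Pow X) (\<subseteq>)"

text \<open>
  Below, the cardinal bounding the size of the families is given by a set \<open>K\<close> of that
  cardinality.  The empty intersection of subsets of \<open>X\<close> is \<open>X\<close>.
\<close>

definition complete_over :: "'a set \<Rightarrow> 'k set \<Rightarrow> 'a set set \<Rightarrow> bool" where
  "complete_over X K F \<longleftrightarrow> (\<forall>\<sigma>\<subseteq>F. \<sigma> \<prec> K \<longrightarrow> X \<inter> \<Inter>\<sigma> \<in> F)"

definition ultrafilter_in :: "'m set_model \<Rightarrow> 'm \<Rightarrow> 'm set \<Rightarrow> bool" where
  "ultrafilter_in M X W \<longleftrightarrow> poset_ultrafilter (powerset_in M X) (sub_in M) W"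

definition complete_in :: "'m set_model \<Rightarrow> 'm \<Rightarrow> 'k set \<Rightarrow> 'm set \<Rightarrow> bool" where
  "complete_in M X K W \<longleftrightarrow>
     (\<forall>\<sigma>\<in>fst M. ext M \<sigma> \<subseteq> W \<and> ext M \<sigma> \<prec> K \<longrightarrow>
        (\<exists>A\<in>W. ext M A = ext M X \<inter> (\<Inter>B\<in>ext M \<sigma>. ext M B)))"

text \<open>The ultrapower of the universe by an ultrafilter \<open>D\<close> over a set \<open>I\<close>.\<close>

definition ultrapower_eq :: "'i set \<Rightarrow> 'i set set \<Rightarrow> (('i \<Rightarrow> 'v) \<times> ('i \<Rightarrow> 'v)) set" where
  "ultrapower_eq I D = {(f, g). f \<in> I \<rightarrow>\<^sub>E UNIV \<and> g \<in> I \<rightarrow>\<^sub>E UNIV \<and> {i\<in>I. f i = g i} \<in> D}"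

definition ultrapower_mem ::
    "('v \<Rightarrow> 'v \<Rightarrow> bool) \<Rightarrow> 'i set \<Rightarrow> 'i set set \<Rightarrow> ('i \<Rightarrow> 'v) set \<Rightarrow> ('i \<Rightarrow> 'v) set \<Rightarrow> bool" where
  "ultrapower_mem E I D x y \<longleftrightarrow> (\<exists>f\<in>x. \<exists>g\<in>y. {i\<in>I. E (f i) (g i)} \<in> D)"

definition ultrapower ::
    "('v \<Rightarrow> 'v \<Rightarrow> bool) \<Rightarrow> 'i set \<Rightarrow> 'i set set \<Rightarrow> ('i \<Rightarrow> 'v) set set_model" where
  "ultrapower E I D = ((I \<rightarrow>\<^sub>E UNIV) // ultrapower_eq I D, ultrapower_mem E I D)"

end

theory Submission
  imports Defs
begin

text \<open>
  A family \<open>\<sigma> \<subseteq> W\<close> with \<open>|\<sigma>| < \<kappa>\<close> need not be covered by a small subset of \<open>W\<close> lying in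
  \<open>M\<close>, but some small partition of \<open>X\<close> in \<open>M\<close> has each of its pieces decided by every member of
  \<open>\<sigma>\<close>, and \<open>W\<close> contains a piece.  So \<open>W\<close> generates a \<open>\<kappa>\<close>-complete filter, which extends to a
  \<open>\<delta>\<close>-complete ultrafilter \<open>U\<close> whose trace on \<open>M\<close> is \<open>W\<close>.  Since \<open>|I| < \<delta>\<close>, choosing
  representatives of the elements of \<open>X\<close> projects \<open>U\<close> to an \<open>I\<close>-indexed family of ultrafilters,
  and the class of this family is \<open>W\<close>.
\<close>

section \<open>Cardinal arithmetic of products\<close>

text \<open>If a factor is infinite, the product embeds into the square of the larger factor, which
  is equipollent to that factor. Cardinals are comparable, so two cases suffice. With
  \<open>A\<close> the index set, this bounds \<open>I \<times> \<sigma>\<close> before a power set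
  is taken.\<close>

lemma times_lesspoll_infinite:
  assumes "infinite C" "A \<prec> C" "B \<prec> C"
  shows "A \<times> B \<prec> C"
proof (cases "finite A \<and> finite B")
  case True
  then show ?thesis
    using assms(1) by (simp add: finite_lesspoll_infinite)
next
  case False
  have sq: "A' \<times> B' \<lesssim> A'" if inf: "infinite A'" and le: "B' \<lesssim> A'" for A' :: "'x set" and B' :: "'y set"
  proof -
    obtain f where "bij_betw f (A' \<times> A') A'"
      using card_of_Times_same_infinite[OF inf] card_of_ordIso by blast
    then have "A' \<times> A' \<lesssim> A'"
      using eqpoll_def eqpoll_imp_lepoll by blast
    moreover have "A' \<times> B' \<lesssim> A' \<times> A'"
      using le by (simp add: times_lepoll_mono)
    ultimately show ?thesis
      using lepoll_trans by blast
  qed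
  consider "A \<lesssim> B" | "B \<lesssim> A"
    using ordLeq_total[OF card_of_Well_order card_of_Well_order, of A B]
    by (auto simp: card_of_ordLeq[symmetric] lepoll_def)
  then show ?thesis
  proof cases
    case 1
    then have "infinite B"
      using False by (metis lepoll_def inj_on_finite)
    then have "A \<times> B \<lesssim> B"
      using sq[of B A] 1 times_commute_eqpoll lepoll_trans1 by blast
    then show ?thesis
      using assms(3) lesspoll_trans1 by blast
  next
    case 2
    then have "infinite A"
      using False by (metis lepoll_def inj_on_finite)
    then show ?thesis
      using sq[of A B] 2 assms(2) lesspoll_trans1 by blast
  qed
qed

section \<open>Ultrafilters on posets of sets\<close>

text \<open>Two kinds of ultrafilter are treated at once: those over a true set, with
  \<open>e\<close> the identity, and those of the ultrapower, with \<open>e\<close> sending an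
  element to its extension. Closure under complements is not among the assumptions, so maximality is
  exploited through disjointness.\<close>

locale ultrafilter_of_sets =
  fixes P :: "'p set" and le :: "'p \<Rightarrow> 'p \<Rightarrow> bool" and e :: "'p \<Rightarrow> 'a set" and U :: "'p set"
  assumes ultrafilter: "poset_ultrafilter P le U"
    and le_iff: "\<And>x y. le x y \<longleftrightarrow> e x \<subseteq> e y"
    and meet: "\<And>x y. x \<in> P \<Longrightarrow> y \<in> P \<Longrightarrow> \<exists>z\<in>P. e z = e x \<inter> e y"
    and bottom: "\<exists>z\<in>P. e z = {}"
begin

lemma filter: "poset_filter P le U"
  using ultrafilter unfolding poset_ultrafilter_def by (rule conjunct1)

lemma subset: "U \<subseteq> P" and nonempty: "U \<noteq> {}" and not_all: "U \<noteq> P"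
  and upward: "x \<in> U \<Longrightarrow> y \<in> P \<Longrightarrow> e x \<subseteq> e y \<Longrightarrow> y \<in> U"
  and directed: "x \<in> U \<Longrightarrow> y \<in> U \<Longrightarrow> \<exists>z\<in>U. e z \<subseteq> e x \<inter> e y"
  using filter unfolding poset_filter_def le_iff Int_subset_iff by blast+

lemma ne: "x \<in> U \<Longrightarrow> e x \<noteq> {}"
  using not_all subset upward by blast

lemma meets: "x \<in> U \<Longrightarrow> y \<in> U \<Longrightarrow> e x \<inter> e y \<noteq> {}"
  using directed ne by fastforce

text \<open>Otherwise \<open>U\<close> and \<open>a\<close> together generate a proper filter
  \<open>?G\<close>; by maximality it equals \<open>U\<close>, which then contains \<open>a\<close>.
  Properness holds because an element with empty extension could enter \<open>?G\<close> only
  through some \<open>x\<close> in \<open>U\<close> disjoint from \<open>a\<close>.\<close>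

lemma disjoint_if_notin:
  assumes a: "a \<in> P" "a \<notin> U"
  shows "\<exists>x\<in>U. e x \<inter> e a = {}"
proof (rule ccontr)
  assume no: "\<not> ?thesis"
  let ?G = "{y \<in> P. \<exists>x\<in>U. e x \<inter> e a \<subseteq> e y}"
  have "poset_filter P le ?G"
    unfolding poset_filter_def le_iff
  proof (intro conjI ballI impI)
    show "?G \<noteq> {}" using a(1) nonempty by blast
    show "?G \<noteq> P" using bottom no by fastforce
    show "\<exists>z\<in>?G. e z \<subseteq> e x \<and> e z \<subseteq> e y" if xy: "x \<in> ?G" "y \<in> ?G" for x y
    proof -
      obtain x' y' where *: "x' \<in> U" "y' \<in> U" "e x' \<inter> e a \<subseteq> e x" "e y' \<inter> e a \<subseteq> e y"
        using xy by blast
      then obtain z where z: "z \<in> U" "e z \<subseteq> e x' \<inter> e y'"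
        using directed[of x' y'] by auto
      obtain w where "w \<in> P" "e w = e z \<inter> e a"
        using meet[of z a] a(1) z(1) subset by auto
      then have "w \<in> ?G" "e w \<subseteq> e x" "e w \<subseteq> e y" using *(3,4) z by auto
      then show ?thesis by blast
    qed
  qed blast+
  moreover have "U \<subseteq> ?G" using subset by blast
  ultimately have "?G = U"
    using ultrafilter unfolding poset_ultrafilter_def by blast
  moreover have "a \<in> ?G" using a(1) nonempty by blast
  ultimately show False using a(2) by blast
qed

end

lemma ultrafilter_over_sets: "ultrafilter_over X U \<Longrightarrow> ultrafilter_of_sets (Pow X) (\<subseteq>) (\<lambda>x. x) U"
  by unfold_locales auto

lemma ultrafilter_over_Int_iff:
  assumes "ultrafilter_over X U" "A \<subseteq> X" "B \<subseteq> X"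
  shows "A \<inter> B \<in> U \<longleftrightarrow> A \<in> U \<and> B \<in> U"
proof -
  interpret ultrafilter_of_sets "Pow X" "(\<subseteq>)" "\<lambda>x. x" U
    using ultrafilter_over_sets[OF assms(1)] .
  show ?thesis
    using directed upward assms(2,3) by (meson Int_lower1 Int_lower2 PowI le_infI1)
qed

lemma ultrafilter_over_Diff_iff:
  assumes "ultrafilter_over X U" "A \<subseteq> X"
  shows "X - A \<in> U \<longleftrightarrow> A \<notin> U"
proof -
  interpret ultrafilter_of_sets "Pow X" "(\<subseteq>)" "\<lambda>x. x" U
    using ultrafilter_over_sets[OF assms(1)] .
  show ?thesis
  proof
    show "A \<notin> U" if "X - A \<in> U" using meets[OF that] by blast
    show "X - A \<in> U" if A: "A \<notin> U"
    proof -
      obtain B where "B \<in> U" "B \<inter> A = {}" using disjoint_if_notin[of A] A assms(2) by auto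
      then show ?thesis using upward[of B "X - A"] subset by blast
    qed
  qed
qed

text \<open>For each \<open>i\<close> one of \<open>Y i\<close> and its complement lies in
  \<open>U\<close>. The displayed set is the intersection of these fewer than \<open>K\<close> many
  choices.\<close>

lemma complete_ultrafilter_decides:
  assumes U: "ultrafilter_over X U" "complete_over X K U" and J: "J \<prec> K"
    and Y: "\<And>i. i \<in> J \<Longrightarrow> Y i \<subseteq> X"
  shows "{x \<in> X. \<forall>i\<in>J. x \<in> Y i \<longleftrightarrow> Y i \<in> U} \<in> U"
proof -
  define Z where "Z i = (if Y i \<in> U then Y i else X - Y i)" for i
  have "Z ` J \<subseteq> U"
    using Y ultrafilter_over_Diff_iff[OF U(1)] unfolding Z_def by auto
  moreover have "Z ` J \<prec> K"
    using J image_lepoll lesspoll_trans1 by blast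
  ultimately have "X \<inter> \<Inter>(Z ` J) \<in> U"
    using U(2) unfolding complete_over_def by blast
  moreover have "X \<inter> \<Inter>(Z ` J) = {x \<in> X. \<forall>i\<in>J. x \<in> Y i \<longleftrightarrow> Y i \<in> U}"
    unfolding Z_def by auto
  ultimately show ?thesis by simp
qed

section \<open>Ordinals and strong limit cardinals of the universe\<close>

context zfc_universe
begin

lemma elts_iff [simp]: "x \<in> elts mem y \<longleftrightarrow> x \<epsilon> y"
  by (simp add: ext_def universe_def)

definition sep :: "'v \<Rightarrow> ('v \<Rightarrow> bool) \<Rightarrow> 'v" where
  "sep a P = (SOME y. \<forall>z. z \<epsilon> y \<longleftrightarrow> z \<epsilon> a \<and> P z)"

lemma sep [simp]: "z \<epsilon> sep a P \<longleftrightarrow> z \<epsilon> a \<and> P z"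
  unfolding sep_def by (rule someI2_ex[OF separation]) blast

definition pow :: "'v \<Rightarrow> 'v" where
  "pow a = (SOME p. \<forall>y. y \<epsilon> p \<longleftrightarrow> (\<forall>z. z \<epsilon> y \<longrightarrow> z \<epsilon> a))"

lemma pow [simp]: "y \<epsilon> pow a \<longleftrightarrow> (\<forall>z. z \<epsilon> y \<longrightarrow> z \<epsilon> a)"
  unfolding pow_def by (rule someI2_ex[OF powerset]) blast

text \<open>Foundation speaks of elements of the universe, while well-foundedness quantifies over
  arbitrary HOL sets \<open>Q\<close>. Restricting to members of \<open>a\<close> lets separation
  turn the part of \<open>Q\<close> inside \<open>a\<close> into an element of the universe.\<close>

lemma wf_mem_elts: "wf {(x, y). x \<epsilon> a \<and> y \<epsilon> a \<and> x \<epsilon> y}"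
proof (rule wfI_min)
  fix x :: 'v and Q assume x: "x \<in> Q"
  show "\<exists>z\<in>Q. \<forall>y. (y, z) \<in> {(x, y). x \<epsilon> a \<and> y \<epsilon> a \<and> x \<epsilon> y} \<longrightarrow> y \<notin> Q"
  proof (cases "x \<epsilon> a")
    case True
    then have "x \<epsilon> sep a (\<lambda>z. z \<in> Q)" using x by simp
    from foundation[OF this] show ?thesis by auto
  qed (use x in blast)
qed

lemma ordinal_less_irrefl:
  assumes "x \<epsilon> a" shows "\<not> x \<epsilon> x"
  using wf_not_refl[OF wf_mem_elts[of a], of x] assms by auto

lemma ordinal_trans: "ordinal mem a \<Longrightarrow> x \<epsilon> y \<Longrightarrow> y \<epsilon> a \<Longrightarrow> x \<epsilon> a"
  and ordinal_linear: "ordinal mem a \<Longrightarrow> x \<epsilon> a \<Longrightarrow> y \<epsilon> a \<Longrightarrow> x \<epsilon> y \<or> x = y \<or> y \<epsilon> x"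
  unfolding ordinal_def subset_iff Ball_def elts_iff by blast+

text \<open>The definition of an ordinal gives transitivity of the set \<open>a\<close>, not of
  membership on it. By linearity only \<open>x = z\<close> and \<open>z \<epsilon> x\<close> must be
  excluded, and either would close a membership cycle inside \<open>a\<close>.\<close>

lemma ordinal_less_trans:
  assumes a: "ordinal mem a" and "x \<epsilon> y" "y \<epsilon> z" "z \<epsilon> a"
  shows "x \<epsilon> z"
proof -
  let ?R = "{(x, y). x \<epsilon> a \<and> y \<epsilon> a \<and> x \<epsilon> y}"
  have in_a: "x \<epsilon> a" "y \<epsilon> a"
    using ordinal_trans[OF a] assms(2-4) by blast+
  have xz: "(x, z) \<in> ?R\<^sup>+"
    using in_a assms(2-4) by (intro trancl_into_trancl[OF r_into_trancl, of x y _ z]) auto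
  have acyc: "acyclic ?R" using wf_mem_elts wf_acyclic by blast
  have "x \<noteq> z" using xz acyc by (auto simp: acyclic_def)
  moreover have "\<not> z \<epsilon> x"
  proof
    assume "z \<epsilon> x"
    then have "(x, x) \<in> ?R\<^sup>+"
      using in_a assms(4) by (intro trancl_into_trancl[OF xz]) auto
    then show False using acyc by (auto simp: acyclic_def)
  qed
  ultimately show ?thesis
    using ordinal_linear[OF a in_a(1) assms(4)] by blast
qed

lemma ordinal_elt:
  assumes "ordinal mem a" "b \<epsilon> a"
  shows "ordinal mem b"
  unfolding ordinal_def
proof (intro conjI ballI subsetI)
  show "z \<in> elts mem b" if "x \<in> elts mem b" "z \<in> elts mem x" for x z
    using ordinal_less_trans[OF assms(1) _ _ assms(2)] that by auto
  show "x \<epsilon> y \<or> x = y \<or> y \<epsilon> x" if "x \<in> elts mem b" "y \<in> elts mem b" for x y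
    using ordinal_linear[OF assms(1)] ordinal_trans[OF assms(1) _ assms(2)] that by auto
qed

text \<open>Membership well-orders \<open>a\<close>, so a smaller cardinal is isomorphic to a proper
  initial segment of this order. Such a segment consists of the predecessors of some
  \<open>b\<close>, which are exactly the members of \<open>b\<close>.\<close>

lemma lesspoll_ordinal:
  assumes a: "ordinal mem a" and B: "B \<prec> elts mem a"
  shows "\<exists>b. b \<epsilon> a \<and> elts mem b \<approx> B"
proof -
  include cardinal_syntax
  let ?A = "elts mem a"
  define r where "r = {(x, y). x \<in> ?A \<and> y \<in> ?A \<and> (x = y \<or> x \<epsilon> y)}"
  have F: "Field r = ?A" unfolding r_def Field_def by auto
  have wo: "well_order_on ?A r"
    unfolding well_order_on_def linear_order_on_def partial_order_on_def preorder_on_def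
  proof (intro conjI)
    show "r \<subseteq> ?A \<times> ?A" "refl_on ?A r" unfolding r_def refl_on_def by auto
    show "trans r"
      by (rule transI) (use ordinal_less_trans[OF a] in \<open>auto simp: r_def\<close>)
    show "antisym r"
    proof (rule antisymI, rule ccontr)
      fix x y assume "(x, y) \<in> r" "(y, x) \<in> r" "x \<noteq> y"
      then have "x \<epsilon> y" "y \<epsilon> x" "x \<epsilon> a" by (auto simp: r_def)
      then show False using ordinal_less_trans[OF a] ordinal_less_irrefl by blast
    qed
    show "total_on ?A r"
      using ordinal_linear[OF a] by (fastforce intro!: total_onI simp: r_def)
    have "r - Id \<subseteq> {(x, y). x \<epsilon> a \<and> y \<epsilon> a \<and> x \<epsilon> y}" unfolding r_def by auto
    then show "wf (r - Id)" using wf_mem_elts wf_subset by blast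
  qed
  then have Wo: "Well_order r" using F by simp
  have "|B| <o |?A|"
  proof -
    have "\<not> ?A \<lesssim> B"
      using B lepoll_antisym unfolding lesspoll_def by blast
    then have "\<not> |?A| \<le>o |B|"
      unfolding lepoll_def card_of_ordLeq[symmetric] .
    then show ?thesis
      using not_ordLeq_iff_ordLess[OF card_of_Well_order card_of_Well_order] by blast
  qed
  \<comment> \<open>\<open>a\<close> need not be a cardinal, so \<open>r\<close> may be longer than
    \<open>|?A|\<close>; but \<open>|?A|\<close> is minimal among the well-orders of
    \<open>?A\<close>.\<close>
  then have "|B| <o r"
    using card_of_least[OF wo] ordLess_ordLeq_trans by blast
  then obtain b where "b \<in> Field r" "|B| =o Restr r (underS r b)"
    unfolding ordLess_iff_ordIso_Restr[OF Wo card_of_Well_order] by blast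
  then have b: "b \<epsilon> a" "|B| =o Restr r (underS r b)"
    using F by auto
  have uS: "underS r b = elts mem b"
    using b(1) ordinal_trans[OF a] ordinal_less_irrefl unfolding underS_def r_def by auto
  have "Field (Restr r (elts mem b)) = elts mem b"
  proof
    show "elts mem b \<subseteq> Field (Restr r (elts mem b))"
    proof
      fix x assume "x \<in> elts mem b"
      then have "(x, x) \<in> Restr r (elts mem b)"
        using b(1) ordinal_trans[OF a] by (auto simp: r_def)
      then show "x \<in> Field (Restr r (elts mem b))" by (rule FieldI1)
    qed
  qed (auto simp: Field_def)
  then have "|B| =o |elts mem b|"
    using card_of_cong[OF b(2)] uS by (simp add: Field_card_of)
  then show ?thesis
    using b(1) by (meson eqpoll_iff_card_of_ordIso eqpoll_sym)
qed

text \<open>The strong limit property mentions only cardinals below \<open>k\<close>. An arbitrary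
  small \<open>B\<close> is replaced by the least ordinal equipollent to it, which is a cardinal by
  minimality.\<close>

lemma strong_limit_Pow_lesspoll:
  assumes k: "strong_limit_cardinal mem k" and B: "B \<prec> elts mem k"
  shows "Pow B \<prec> elts mem k"
proof -
  have ord: "ordinal mem k" using k by (simp add: strong_limit_cardinal_def cardinal_def)
  obtain b where "b \<epsilon> sep k (\<lambda>b. elts mem b \<approx> B)"
    using lesspoll_ordinal[OF ord B] unfolding sep by blast
  from foundation[OF this] obtain l where l: "l \<epsilon> k" "elts mem l \<approx> B"
    and least: "\<And>z. z \<epsilon> k \<Longrightarrow> elts mem z \<approx> B \<Longrightarrow> \<not> z \<epsilon> l"
    unfolding sep by blast
  have "cardinal mem l"
    unfolding cardinal_def
  proof (intro conjI ballI)
    show "ordinal mem l" using ordinal_elt[OF ord l(1)] .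
    fix z assume z: "z \<in> elts mem l"
    then have "z \<epsilon> k" using ordinal_trans[OF ord _ l(1)] by simp
    then show "\<not> elts mem z \<approx> elts mem l"
      using least[of z] z l(2) eqpoll_trans by auto
  qed
  then have "Pow (elts mem l) \<prec> elts mem k"
    using k l(1) unfolding strong_limit_cardinal_def by simp
  moreover obtain f where "B = f ` elts mem l"
    using l(2) unfolding eqpoll_def bij_betw_def by blast
  then have "Pow B \<lesssim> Pow (elts mem l)"
    using subset_image_lepoll[of "Pow B" "(`) f" "Pow (elts mem l)"] by (simp add: image_Pow_surj)
  ultimately show ?thesis using lesspoll_trans1 by blast
qed

end

section \<open>The ultrapower and the instances of Los's theorem\<close>

locale ultrapower_of_universe = zfc_universe mem
  for mem :: "'v \<Rightarrow> 'v \<Rightarrow> bool" (infix \<open>\<epsilon>\<close> 50) +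
  fixes I :: "'i set" and D :: "'i set set"
  assumes ultra: "ultrafilter_over I D"
begin

abbreviation M :: "('i \<Rightarrow> 'v) set set_model" where
  "M \<equiv> ultrapower mem I D"

text \<open>This is the quantifier "for \<open>D\<close>-almost all indices". It commutes with
  conjunction and negation, which gives the Boolean part of Los's theorem.\<close>

definition most :: "('i \<Rightarrow> bool) \<Rightarrow> bool" where
  "most P \<longleftrightarrow> {i\<in>I. P i} \<in> D"

text \<open>The restriction allows any HOL function as a representative, although the carrier is
  built from functions that are \<open>undefined\<close> off \<open>I\<close>.\<close>

definition cls :: "('i \<Rightarrow> 'v) \<Rightarrow> ('i \<Rightarrow> 'v) set" where
  "cls f = ultrapower_eq I D `` {restrict f I}"

lemma most_conj: "most (\<lambda>i. P i \<and> Q i) \<longleftrightarrow> most P \<and> most Q"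
proof -
  have "{i\<in>I. P i \<and> Q i} = {i\<in>I. P i} \<inter> {i\<in>I. Q i}" by blast
  then show ?thesis
    unfolding most_def using ultrafilter_over_Int_iff[OF ultra, of "{i\<in>I. P i}" "{i\<in>I. Q i}"] by simp
qed

lemma most_not: "most (\<lambda>i. \<not> P i) \<longleftrightarrow> \<not> most P"
proof -
  have "{i\<in>I. \<not> P i} = I - {i\<in>I. P i}" by blast
  then show ?thesis
    unfolding most_def using ultrafilter_over_Diff_iff[OF ultra, of "{i\<in>I. P i}"] by simp
qed

lemma most_mono: "most P \<Longrightarrow> (\<And>i. i \<in> I \<Longrightarrow> P i \<Longrightarrow> Q i) \<Longrightarrow> most Q"
proof -
  assume P: "most P" and PQ: "\<And>i. i \<in> I \<Longrightarrow> P i \<Longrightarrow> Q i"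
  have "{i\<in>I. P i} = {i\<in>I. P i \<and> Q i}" using PQ by blast
  then have "most (\<lambda>i. P i \<and> Q i)" using P by (simp add: most_def)
  then show ?thesis using most_conj by blast
qed

lemma most_mono2:
  assumes "most P" "most Q" "\<And>i. i \<in> I \<Longrightarrow> P i \<Longrightarrow> Q i \<Longrightarrow> R i"
  shows "most R"
proof -
  have "most (\<lambda>i. P i \<and> Q i)" using assms most_conj by blast
  then show ?thesis by (rule most_mono) (use assms(3) in blast)
qed

lemma most_cong: "(\<And>i. i \<in> I \<Longrightarrow> P i \<longleftrightarrow> Q i) \<Longrightarrow> most P \<longleftrightarrow> most Q"
  using most_mono by blast

lemma most_all: "(\<And>i. i \<in> I \<Longrightarrow> P i) \<Longrightarrow> most P"
proof -
  assume P: "\<And>i. i \<in> I \<Longrightarrow> P i"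
  have "most P \<or> most (\<lambda>i. \<not> P i)" using most_not by blast
  then show ?thesis by (rule disjE) (auto elim: most_mono simp: P)
qed

lemma not_most_False: "\<not> most (\<lambda>i. False)"
  using most_not[of "\<lambda>i. False"] most_all[of "\<lambda>i. True"] by simp

lemma mem_cls_iff: "g \<in> cls f \<longleftrightarrow> g \<in> I \<rightarrow>\<^sub>E UNIV \<and> most (\<lambda>i. f i = g i)"
proof -
  have "{i \<in> I. restrict f I i = g i} = {i \<in> I. f i = g i}" by auto
  then show ?thesis unfolding cls_def ultrapower_eq_def most_def by auto
qed

lemma restrict_in_cls: "restrict f I \<in> cls f"
  unfolding mem_cls_iff by (auto intro: most_all)

lemma cls_eq_iff: "cls f = cls g \<longleftrightarrow> most (\<lambda>i. f i = g i)"
proof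
  assume "cls f = cls g"
  then have "restrict g I \<in> cls f" using restrict_in_cls by blast
  then have "most (\<lambda>i. f i = restrict g I i)" unfolding mem_cls_iff by blast
  then show "most (\<lambda>i. f i = g i)" by (rule most_mono) simp
next
  assume fg: "most (\<lambda>i. f i = g i)"
  have "most (\<lambda>i. f i = h i) \<longleftrightarrow> most (\<lambda>i. g i = h i)" for h
    using most_mono2[OF fg, of "\<lambda>i. f i = h i" "\<lambda>i. g i = h i"]
      most_mono2[OF fg, of "\<lambda>i. g i = h i" "\<lambda>i. f i = h i"] by auto
  then show "cls f = cls g" unfolding set_eq_iff mem_cls_iff by blast
qed

lemma carrier_eq: "fst M = range cls"
proof
  show "fst M \<subseteq> range cls"
    unfolding ultrapower_def fst_conv quotient_def
  proof clarify
    fix f :: "'i \<Rightarrow> 'v" assume "f \<in> I \<rightarrow>\<^sub>E UNIV"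
    then have "restrict f I = f" by (rule PiE_restrict)
    then have "ultrapower_eq I D `` {f} = cls f" by (simp add: cls_def)
    then show "ultrapower_eq I D `` {f} \<in> range cls" by simp
  qed
  have "restrict f I \<in> I \<rightarrow>\<^sub>E UNIV" for f :: "'i \<Rightarrow> 'v" by simp
  then show "range cls \<subseteq> fst M"
    unfolding ultrapower_def fst_conv quotient_def cls_def by blast
qed

lemma cls_in [simp]: "cls f \<in> fst M"
  by (simp add: carrier_eq)

lemma obtain_cls:
  assumes "x \<in> fst M" obtains f where "x = cls f"
  using assms carrier_eq by auto

lemma ultrapower_mem_cls_iff: "snd M (cls f) (cls g) \<longleftrightarrow> most (\<lambda>i. f i \<epsilon> g i)"
proof
  assume "snd M (cls f) (cls g)"
  then obtain f' g' where *: "f' \<in> cls f" "g' \<in> cls g" "most (\<lambda>i. f' i \<epsilon> g' i)"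
    unfolding ultrapower_def ultrapower_mem_def most_def by auto
  then have "most (\<lambda>i. f i = f' i \<and> g i = g' i)"
    unfolding mem_cls_iff most_conj by blast
  with *(3) show "most (\<lambda>i. f i \<epsilon> g i)" by (rule most_mono2) simp
next
  assume fg: "most (\<lambda>i. f i \<epsilon> g i)"
  have "most (\<lambda>i. restrict f I i \<epsilon> restrict g I i)" by (rule most_mono[OF fg]) simp
  then show "snd M (cls f) (cls g)"
    unfolding ultrapower_def ultrapower_mem_def most_def snd_conv using restrict_in_cls by blast
qed

lemma in_ext_iff: "cls f \<in> ext M (cls g) \<longleftrightarrow> most (\<lambda>i. f i \<epsilon> g i)"
  by (simp add: ext_def ultrapower_mem_cls_iff)

lemma ext_subset_carrier: "ext M x \<subseteq> fst M"
  by (auto simp: ext_def)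

lemma sub_in_iff: "sub_in M x y \<longleftrightarrow> ext M x \<subseteq> ext M y"
  by (auto simp: sub_in_def ext_def)

lemma mem_powerset_in: "x \<in> powerset_in M X \<longleftrightarrow> x \<in> fst M \<and> ext M x \<subseteq> ext M X"
  by (simp add: powerset_in_def sub_in_iff)

lemma ext_subset_if_subset_powerset_in:
  assumes "W \<subseteq> powerset_in M X" "B \<in> W"
  shows "ext M B \<subseteq> ext M X"
  using mem_powerset_in[of B X] assms by blast

text \<open>If inclusion failed at almost all indices, choosing a counterexample at each index would
  represent an element of the first extension outside the second.\<close>

lemma ext_subset_most:
  assumes "ext M (cls f) \<subseteq> ext M (cls g)"
  shows "most (\<lambda>i. \<forall>z. z \<epsilon> f i \<longrightarrow> z \<epsilon> g i)"
proof (rule ccontr)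
  define h where "h i = (SOME z. z \<epsilon> f i \<and> \<not> z \<epsilon> g i)" for i
  assume "\<not> ?thesis"
  then have "most (\<lambda>i. \<not> (\<forall>z. z \<epsilon> f i \<longrightarrow> z \<epsilon> g i))" using most_not by blast
  then have h: "most (\<lambda>i. h i \<epsilon> f i \<and> \<not> h i \<epsilon> g i)"
  proof (rule most_mono)
    fix i assume "\<not> (\<forall>z. z \<epsilon> f i \<longrightarrow> z \<epsilon> g i)"
    then have "\<exists>z. z \<epsilon> f i \<and> \<not> z \<epsilon> g i" by blast
    then show "h i \<epsilon> f i \<and> \<not> h i \<epsilon> g i" unfolding h_def by (rule someI_ex)
  qed
  then have "cls h \<in> ext M (cls f)" "cls h \<notin> ext M (cls g)"
    unfolding in_ext_iff most_conj most_not by blast+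
  then show False using assms by blast
qed

lemma ex_ext_Int:
  assumes "x \<in> fst M" "y \<in> fst M"
  shows "\<exists>z\<in>fst M. ext M z = ext M x \<inter> ext M y"
proof -
  obtain f g where fg: "x = cls f" "y = cls g"
    using assms obtain_cls by metis
  have "cls h \<in> ext M (cls (\<lambda>i. sep (f i) (\<lambda>z. z \<epsilon> g i))) \<longleftrightarrow> cls h \<in> ext M x \<inter> ext M y" for h
    by (simp add: fg in_ext_iff most_conj)
  then have "ext M (cls (\<lambda>i. sep (f i) (\<lambda>z. z \<epsilon> g i))) = ext M x \<inter> ext M y"
    using ext_subset_carrier[unfolded carrier_eq] by blast
  then show ?thesis using cls_in by blast
qed

lemma ex_ext_empty: "\<exists>z\<in>fst M. ext M z = {}"
proof -
  have "cls h \<notin> ext M (cls (\<lambda>i. sep x (\<lambda>z. False)))" for h x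
    by (simp add: in_ext_iff not_most_False)
  then have "ext M (cls (\<lambda>i. sep x (\<lambda>z. False))) = {}" for x
    using ext_subset_carrier[unfolded carrier_eq] by blast
  then show ?thesis using cls_in by blast
qed

section \<open>Ultrafilters of the ultrapower and their true completeness\<close>

lemma ultrafilter_in_sets:
  assumes "ultrafilter_in M X W"
  shows "ultrafilter_of_sets (powerset_in M X) (sub_in M) (ext M) W"
proof
  show "poset_ultrafilter (powerset_in M X) (sub_in M) W"
    using assms by (simp add: ultrafilter_in_def)
  show "\<exists>z\<in>powerset_in M X. ext M z = ext M x \<inter> ext M y"
    if xy: "x \<in> powerset_in M X" "y \<in> powerset_in M X" for x y
    using ex_ext_Int[of x y] xy unfolding Bex_def mem_powerset_in by blast
  show "\<exists>z\<in>powerset_in M X. ext M z = {}"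
    using ex_ext_empty unfolding Bex_def mem_powerset_in by blast
qed (rule sub_in_iff)

text \<open>
  The index-wise atoms of the algebra generated by representatives of \<open>\<sigma>\<close> form a partition
  of \<open>X\<close> that lies in \<open>M\<close>, although \<open>\<sigma>\<close> need not.  The set of complements of the atoms is the
  image of \<open>Pow (I \<times> \<sigma>)\<close>, so by completeness in \<open>M\<close> it is not included in \<open>W\<close>.
\<close>

lemma small_subset_has_lower_bound:
  assumes W: "ultrafilter_in M X W" "complete_in M X K W" and X: "X \<in> fst M"
    and \<sigma>: "\<sigma> \<subseteq> W" and small: "Pow (I \<times> \<sigma>) \<prec> K"
  shows "\<exists>b\<in>W. \<forall>s\<in>\<sigma>. ext M b \<subseteq> ext M s"
proof -
  interpret W: ultrafilter_of_sets "powerset_in M X" "sub_in M" "ext M" W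
    using ultrafilter_in_sets[OF W(1)] .
  obtain g where g: "X = cls g" using X obtain_cls by blast
  have "\<forall>s\<in>\<sigma>. \<exists>f. s = cls f"
    using \<sigma> W.subset carrier_eq unfolding powerset_in_def by blast
  then obtain r where r: "\<And>s. s \<in> \<sigma> \<Longrightarrow> s = cls (r s)" by metis
  define atom where "atom Z i = sep (g i) (\<lambda>x. \<forall>s\<in>\<sigma>. x \<epsilon> r s i \<longleftrightarrow> (i, s) \<in> Z)" for Z i
  define coatom where "coatom Z i = sep (g i) (\<lambda>x. \<not> x \<epsilon> atom Z i)" for Z i
  define \<Sigma> where "\<Sigma> = cls (\<lambda>i. sep (pow (g i)) (\<lambda>y. \<exists>Z\<subseteq>I\<times>\<sigma>. y = coatom Z i))"
  have ext_\<Sigma>: "ext M \<Sigma> \<subseteq> (\<lambda>Z. cls (coatom Z)) ` Pow (I \<times> \<sigma>)"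
  proof
    fix x assume x: "x \<in> ext M \<Sigma>"
    then obtain c where c: "x = cls c" using ext_subset_carrier obtain_cls by blast
    define Z where "Z i = (SOME Z. Z \<subseteq> I \<times> \<sigma> \<and> c i = coatom Z i)" for i
    \<comment> \<open>An element of \<open>\<Sigma>\<close> may use a different \<open>Z i\<close>
      at each index. Since \<open>coatom Z i\<close> depends only on the section of \<open>Z\<close>
      at \<open>i\<close>, these choices glue to the single set \<open>Z'\<close>; this is why
      \<open>Z\<close> ranges over subsets of \<open>I \<times> \<sigma>\<close>.\<close>
    define Z' where "Z' = {(i, s). i \<in> I \<and> s \<in> \<sigma> \<and> (i, s) \<in> Z i}"
    have "most (\<lambda>i. c i \<epsilon> pow (g i) \<and> (\<exists>Z\<subseteq>I\<times>\<sigma>. c i = coatom Z i))"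
      using x unfolding c \<Sigma>_def in_ext_iff sep .
    then have "most (\<lambda>i. c i = coatom Z' i)"
    proof (rule most_mono)
      fix i assume i: "i \<in> I" "c i \<epsilon> pow (g i) \<and> (\<exists>Z\<subseteq>I\<times>\<sigma>. c i = coatom Z i)"
      then have "\<exists>Z. Z \<subseteq> I\<times>\<sigma> \<and> c i = coatom Z i" by blast
      then have "c i = coatom (Z i) i" unfolding Z_def by (rule someI2_ex) blast
      also have "\<dots> = coatom Z' i"
        using i(1) by (intro extensionality) (auto simp: coatom_def atom_def Z'_def)
      finally show "c i = coatom Z' i" .
    qed
    then have "x = cls (coatom Z')" using c cls_eq_iff by blast
    moreover have "Z' \<in> Pow (I \<times> \<sigma>)" unfolding Z'_def by blast
    ultimately show "x \<in> (\<lambda>Z. cls (coatom Z)) ` Pow (I \<times> \<sigma>)" by blast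
  qed
  have coatom_in_\<Sigma>: "cls (coatom Z) \<in> ext M \<Sigma>" if "Z \<subseteq> I \<times> \<sigma>" for Z
    unfolding \<Sigma>_def in_ext_iff by (rule most_all) (use that in \<open>auto simp: coatom_def\<close>)
  have "ext M \<Sigma> \<prec> K"
    using subset_image_lepoll[OF ext_\<Sigma>] small lesspoll_trans1 by blast
  have "\<not> ext M \<Sigma> \<subseteq> W"
  proof
    assume "ext M \<Sigma> \<subseteq> W"
    then obtain A where A: "A \<in> W" "ext M A = ext M X \<inter> (\<Inter>B\<in>ext M \<Sigma>. ext M B)"
      using W(2) \<open>ext M \<Sigma> \<prec> K\<close> unfolding complete_in_def \<Sigma>_def by (meson cls_in)
    obtain x where x: "x \<in> ext M A" using W.ne[OF A(1)] by blast
    then obtain h where h: "x = cls h" using ext_subset_carrier obtain_cls by blast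
    \<comment> \<open>\<open>Z\<close> records the memberships of \<open>h\<close> itself, so
      \<open>h\<close> lies in the atom of \<open>Z\<close> and cannot lie in its coatom.\<close>
    define Z where "Z = {(i, s). i \<in> I \<and> s \<in> \<sigma> \<and> h i \<epsilon> r s i}"
    have "most (\<lambda>i. h i \<epsilon> coatom Z i)"
      using x A(2) coatom_in_\<Sigma>[of Z] unfolding h in_ext_iff[symmetric] Z_def by blast
    then have "most (\<lambda>i. False)"
      by (rule most_mono) (auto simp: coatom_def atom_def Z_def)
    then show False using not_most_False by blast
  qed
  then obtain Z where "cls (coatom Z) \<notin> W"
    using ext_\<Sigma> by blast
  moreover have "cls (coatom Z) \<in> powerset_in M X"
  proof -
    have "cls h \<in> ext M (cls (coatom Z)) \<Longrightarrow> cls h \<in> ext M X" for h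
      unfolding g in_ext_iff by (erule most_mono) (simp add: coatom_def)
    then show ?thesis
      unfolding mem_powerset_in using ext_subset_carrier[unfolded carrier_eq] cls_in by blast
  qed
  ultimately obtain b where b: "b \<in> W" "ext M b \<inter> ext M (cls (coatom Z)) = {}"
    using W.disjoint_if_notin by blast
  have atom: "most (\<lambda>i. h i \<epsilon> atom Z i)" if h: "cls h \<in> ext M b" for h
  proof -
    have "cls h \<in> ext M X"
      using h ext_subset_if_subset_powerset_in[OF W.subset b(1)] by blast
    then have "most (\<lambda>i. h i \<epsilon> g i)" unfolding g in_ext_iff .
    moreover have "most (\<lambda>i. \<not> h i \<epsilon> coatom Z i)"
      using h b(2) unfolding most_not in_ext_iff[symmetric] by blast
    ultimately show ?thesis by (rule most_mono2) (simp add: coatom_def)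
  qed
  have "ext M b \<subseteq> ext M s" if s: "s \<in> \<sigma>" for s
  proof -
    \<comment> \<open>One common point suffices: it shows that \<open>(i, s) \<in> Z\<close> for
      almost all \<open>i\<close>, and then every point of \<open>b\<close>, lying in the same atom,
      belongs to \<open>s\<close>.\<close>
    obtain h where h: "cls h \<in> ext M b" "cls h \<in> ext M s"
      using W.meets[OF b(1), of s] s \<sigma> ext_subset_carrier[of b] unfolding carrier_eq by blast
    have "most (\<lambda>i. h i \<epsilon> r s i)" using h(2) r[OF s] in_ext_iff by metis
    with atom[OF h(1)] have Z: "most (\<lambda>i. (i, s) \<in> Z)"
      by (rule most_mono2) (use s in \<open>auto simp: atom_def\<close>)
    have "cls h' \<in> ext M s" if h': "cls h' \<in> ext M b" for h'
    proof -
      have "most (\<lambda>i. h' i \<epsilon> r s i)"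
        using atom[OF h'] Z by (rule most_mono2) (use s in \<open>auto simp: atom_def\<close>)
      then show ?thesis using r[OF s] in_ext_iff by metis
    qed
    then show ?thesis using ext_subset_carrier[of b] unfolding carrier_eq by blast
  qed
  then show ?thesis using b(1) by blast
qed

text \<open>Completeness here concerns all families in the universe, not just those in
  \<open>M\<close>. Below each member of a small family choose an element of \<open>W\<close>; the
  chosen elements have a common lower bound in \<open>W\<close> by the preceding lemma.\<close>

lemma generated_filter:
  assumes W: "ultrafilter_in M X W" "complete_in M X K W" and X: "X \<in> fst M"
    and small: "\<And>\<sigma> :: ('i \<Rightarrow> 'v) set set. \<sigma> \<prec> K \<Longrightarrow> Pow (I \<times> \<sigma>) \<prec> K"
  defines "F \<equiv> {A. A \<subseteq> ext M X \<and> (\<exists>B\<in>W. ext M B \<subseteq> A)}"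
  shows "filter_over (ext M X) F" "complete_over (ext M X) K F"
proof -
  interpret W: ultrafilter_of_sets "powerset_in M X" "sub_in M" "ext M" W
    using ultrafilter_in_sets[OF W(1)] .
  show "filter_over (ext M X) F"
    unfolding poset_filter_def
  proof (intro conjI ballI impI)
    obtain B where "B \<in> W" using W.nonempty by blast
    then have "ext M B \<in> F"
      using ext_subset_if_subset_powerset_in[OF W.subset] unfolding F_def by blast
    then show "F \<noteq> {}" by blast
    have "{} \<notin> F" using W.ne unfolding F_def by blast
    then show "F \<noteq> Pow (ext M X)" by blast
    show "F \<subseteq> Pow (ext M X)" unfolding F_def by blast
    show "y \<in> F" if "x \<in> F" "y \<in> Pow (ext M X)" "x \<subseteq> y" for x y
      using that unfolding F_def by blast
    show "\<exists>z\<in>F. z \<subseteq> x \<and> z \<subseteq> y" if xy: "x \<in> F" "y \<in> F" for x y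
    proof -
      obtain B C where BC: "B \<in> W" "C \<in> W" "ext M B \<subseteq> x" "ext M C \<subseteq> y"
        using xy unfolding F_def by blast
      obtain B' where "B' \<in> W" "ext M B' \<subseteq> ext M B \<inter> ext M C"
        using W.directed[OF BC(1,2)] by blast
      then have "x \<inter> y \<in> F" using BC xy unfolding F_def by blast
      then show ?thesis by blast
    qed
  qed
  show "complete_over (ext M X) K F"
    unfolding complete_over_def
  proof (intro allI impI)
    fix \<tau> assume \<tau>: "\<tau> \<subseteq> F" "\<tau> \<prec> K"
    have "\<forall>A\<in>\<tau>. \<exists>B\<in>W. ext M B \<subseteq> A" using \<tau>(1) unfolding F_def by blast
    then obtain \<beta> where \<beta>: "\<And>A. A \<in> \<tau> \<Longrightarrow> \<beta> A \<in> W" "\<And>A. A \<in> \<tau> \<Longrightarrow> ext M (\<beta> A) \<subseteq> A"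
      by metis
    have "\<beta> ` \<tau> \<prec> K" using \<tau>(2) image_lepoll lesspoll_trans1 by blast
    then obtain b where b: "b \<in> W" "\<forall>s\<in>\<beta> ` \<tau>. ext M b \<subseteq> ext M s"
      using small_subset_has_lower_bound[OF W X, of "\<beta> ` \<tau>"] small \<beta>(1) by blast
    have "ext M b \<subseteq> ext M X" using ext_subset_if_subset_powerset_in[OF W.subset b(1)] .
    moreover have "ext M b \<subseteq> A" if "A \<in> \<tau>" for A using b(2) \<beta>(2) that by blast
    ultimately show "ext M X \<inter> \<Inter>\<tau> \<in> F" using b(1) unfolding F_def by blast
  qed
qed

text \<open>
  Choosing a representative \<open>h x\<close> of each \<open>x \<in> ext M X\<close>, the ultrafilter \<open>W\<close> is represented by
  the images of \<open>U\<close> under the coordinate maps \<open>x \<mapsto> h x i\<close>.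
\<close>

lemma trace_of_complete_ultrafilter_in:
  assumes U: "ultrafilter_over (ext M X) U" "complete_over (ext M X) K U"
    and I: "I \<prec> K" and X: "X \<in> fst M"
    and W: "\<And>A. A \<in> W \<longleftrightarrow> A \<in> powerset_in M X \<and> ext M A \<in> U"
  shows "\<exists>w\<in>fst M. ext M w = W"
proof -
  obtain g where g: "X = cls g" using X obtain_cls by blast
  have "\<forall>x\<in>ext M X. \<exists>f. x = cls f"
    using ext_subset_carrier carrier_eq by blast
  then obtain h where h: "\<And>x. x \<in> ext M X \<Longrightarrow> x = cls (h x)" by metis
  define Y where "Y f i = {x \<in> ext M X. h x i \<epsilon> f i}" for f i
  define w where "w = cls (\<lambda>i. sep (pow (g i)) (\<lambda>y. {x \<in> ext M X. h x i \<epsilon> y} \<in> U))"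
  have ext_iff: "ext M (cls f) \<in> U \<longleftrightarrow> most (\<lambda>i. Y f i \<in> U)"
    if f: "cls f \<in> powerset_in M X" for f
  proof -
    interpret U: ultrafilter_of_sets "Pow (ext M X)" "(\<subseteq>)" "\<lambda>x. x" U
      using ultrafilter_over_sets[OF U(1)] .
    \<comment> \<open>On this set all coordinates are decided simultaneously, so whether a point
      lies in \<open>cls f\<close> no longer depends on the point. It belongs to \<open>U\<close>
      because \<open>I \<prec> K\<close>.\<close>
    let ?S = "{x \<in> ext M X. \<forall>i\<in>I. x \<in> Y f i \<longleftrightarrow> Y f i \<in> U}"
    have S: "?S \<in> U"
      by (rule complete_ultrafilter_decides[OF U I]) (auto simp: Y_def)
    have eq: "x \<in> ext M (cls f) \<longleftrightarrow> most (\<lambda>i. Y f i \<in> U)" if x: "x \<in> ?S" for x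
    proof -
      have "x \<in> ext M (cls f) \<longleftrightarrow> most (\<lambda>i. h x i \<epsilon> f i)"
        using h[of x] x in_ext_iff[of "h x" f] by simp
      also have "\<dots> \<longleftrightarrow> most (\<lambda>i. Y f i \<in> U)"
        by (rule most_cong) (use x in \<open>auto simp: Y_def\<close>)
      finally show ?thesis .
    qed
    show ?thesis
    proof
      assume "ext M (cls f) \<in> U"
      then show "most (\<lambda>i. Y f i \<in> U)" using U.meets[OF S] eq by blast
    next
      assume "most (\<lambda>i. Y f i \<in> U)"
      then have "?S \<subseteq> ext M (cls f)" using eq by blast
      then show "ext M (cls f) \<in> U"
        using U.upward[OF S] f unfolding mem_powerset_in by blast
    qed
  qed
  have "cls f \<in> ext M w \<longleftrightarrow> cls f \<in> W" for f
  proof -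
    have "cls f \<in> ext M w \<longleftrightarrow> most (\<lambda>i. \<forall>z. z \<epsilon> f i \<longrightarrow> z \<epsilon> g i) \<and> most (\<lambda>i. Y f i \<in> U)"
      unfolding w_def in_ext_iff by (simp add: most_conj Y_def)
    also have "most (\<lambda>i. \<forall>z. z \<epsilon> f i \<longrightarrow> z \<epsilon> g i) \<longleftrightarrow> cls f \<in> powerset_in M X"
    proof
      assume sub: "most (\<lambda>i. \<forall>z. z \<epsilon> f i \<longrightarrow> z \<epsilon> g i)"
      have "cls k \<in> ext M (cls f) \<Longrightarrow> cls k \<in> ext M X" for k
        unfolding g in_ext_iff by (rule most_mono2[OF sub]) blast+
      then show "cls f \<in> powerset_in M X"
        unfolding mem_powerset_in using ext_subset_carrier[unfolded carrier_eq] cls_in by blast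
    qed (use ext_subset_most g in \<open>simp add: mem_powerset_in\<close>)
    finally show ?thesis using ext_iff W by blast
  qed
  moreover have "W \<subseteq> fst M" using W by (auto simp: mem_powerset_in)
  ultimately have "ext M w = W"
    using ext_subset_carrier[of w] unfolding carrier_eq by blast
  then show ?thesis unfolding w_def using cls_in by blast
qed

end

section \<open>Extending the generated filter and reading off its trace\<close>

theorem theorem3p7:
  fixes E :: "'v \<Rightarrow> 'v \<Rightarrow> bool"
    and \<delta> \<kappa> I :: 'v
    and D :: "'v set set"
    and M :: "('v \<Rightarrow> 'v) set set_model"
    and X :: "('v \<Rightarrow> 'v) set"
    and W :: "('v \<Rightarrow> 'v) set set"
  assumes "zfc_universe E"
    and "cardinal E \<delta>"
    and "strong_limit_cardinal E \<kappa>"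
    and "\<delta> = \<kappa> \<or> E \<delta> \<kappa>"
    and "elts E I \<prec> elts E \<delta>"
    and "ultrafilter_over (elts E I) D"
    and "M = ultrapower E (elts E I) D"
    and "X \<in> fst M"
    and "ultrafilter_in M X W"
    and "complete_in M X (elts E \<kappa>) W"
    and "\<forall>F. filter_over (ext M X) F \<and> complete_over (ext M X) (elts E \<kappa>) F \<longrightarrow>
           (\<exists>U. F \<subseteq> U \<and> ultrafilter_over (ext M X) U \<and> complete_over (ext M X) (elts E \<delta>) U)"
  shows "\<exists>w\<in>fst M. ext M w = W"
proof -
  interpret zfc_universe E by (rule assms(1))
  interpret Ult: ultrapower_of_universe E "elts E I" D
    by unfold_locales (rule assms(6))
  note W = assms(9,10)[unfolded assms(7)] and X = assms(8)[unfolded assms(7)]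
  interpret W: ultrafilter_of_sets "powerset_in Ult.M X" "sub_in Ult.M" "ext Ult.M" W
    using Ult.ultrafilter_in_sets[OF W(1)] .
  have \<kappa>: "ordinal E \<kappa>" "infinite (elts E \<kappa>)"
    using assms(3) by (simp_all add: strong_limit_cardinal_def cardinal_def)
  have "elts E \<delta> \<subseteq> elts E \<kappa>"
    using assms(4) ordinal_trans[OF \<kappa>(1)] by auto
  then have I: "elts E I \<prec> elts E \<kappa>"
    using assms(5) subset_imp_lepoll lesspoll_trans2 by blast
  \<comment> \<open>The strong limit hypothesis enters here: it keeps the number of atoms below
    \<open>\<kappa>\<close>.\<close>
  have small: "Pow (elts E I \<times> \<sigma>) \<prec> elts E \<kappa>" if "\<sigma> \<prec> elts E \<kappa>" for \<sigma> :: "('v \<Rightarrow> 'v) set set"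
    using strong_limit_Pow_lesspoll[OF assms(3)] times_lesspoll_infinite[OF \<kappa>(2) I that] by blast
  let ?F = "{A. A \<subseteq> ext Ult.M X \<and> (\<exists>B\<in>W. ext Ult.M B \<subseteq> A)}"
  obtain U where U: "?F \<subseteq> U" "ultrafilter_over (ext Ult.M X) U"
      "complete_over (ext Ult.M X) (elts E \<delta>) U"
    using assms(11)[unfolded assms(7)] Ult.generated_filter[OF W X small] by meson
  interpret U: ultrafilter_of_sets "Pow (ext Ult.M X)" "(\<subseteq>)" "\<lambda>x. x" U
    using ultrafilter_over_sets[OF U(2)] .
  have trace: "A \<in> W \<longleftrightarrow> A \<in> powerset_in Ult.M X \<and> ext Ult.M A \<in> U" for A
  proof
    have W_U: "ext Ult.M B \<in> U" if "B \<in> W" for B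
      using that U(1) Ult.ext_subset_if_subset_powerset_in[OF W.subset] by blast
    show "A \<in> powerset_in Ult.M X \<and> ext Ult.M A \<in> U" if "A \<in> W"
      using that W_U W.subset by blast
    show "A \<in> W" if A: "A \<in> powerset_in Ult.M X \<and> ext Ult.M A \<in> U"
    \<comment> \<open>A set of \<open>M\<close> outside \<open>W\<close> is disjoint from a member
      of \<open>W\<close>, whose extension is in \<open>U\<close>; two disjoint sets cannot both be
      in \<open>U\<close>.\<close>
    proof (rule ccontr)
      assume "A \<notin> W"
      then obtain B where B: "B \<in> W" "ext Ult.M B \<inter> ext Ult.M A = {}"
        using W.disjoint_if_notin[of A] A by blast
      then show False using U.meets[OF W_U[OF B(1)], of "ext Ult.M A"] A by blast
    qed
  qed
  show ?thesis
    unfolding assms(7)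
    \<comment> \<open>Here the sharper bound of \<open>I\<close> by \<open>\<delta>\<close> is
      required, since \<open>U\<close> is only known to be \<open>\<delta>\<close>-complete.\<close>
    by (rule Ult.trace_of_complete_ultrafilter_in[OF U(2,3) assms(5) X trace])
qed

end
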